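(* For every integer $n\geq 5$, the signed Roman domination number of the graph $T_n''$ satisfies $$\frac{7n}{15}\leq\gamma_{sR}(T_n'')\leq h(n),$$ where $h(n)=\left\lceil\frac{2n}{3}\right\rceil$ if $n$ is divisible by $3$, and $h(n)=\left\lceil\frac{2n}{3}\right\rceil+1$ otherwise.
   Context: Graphs are finite, undirected and simple. For a vertex $v$ of a graph $G=(V,E)$, $N(v)=\{u\in V\mid uv\in E\}$ and $N[v]=N(v)\cup\{v\}$. A signed Roman domination (SRD) function on $G$ is a function $f:V\to\{-1,1,2\}$ such that (i) $\sum_{u\in N[v]}f(u)\geq 1$ for every $v\in V$, and (ii) every $v\in V$ with $f(v)=-1$ has a neighbor $u\in N(v)$ with $f(u)=2$. The weight of $f$ is $f(V)=\sum_{v\in V}f(v)$, and the signed Roman domination number $\gamma_{sR}(G)$ is the minimum weight of an SRD function on $G$. The graph $T_n''$ has $4n$ distinct vertices $V(T_n'')=\{a_i,b_i,c_i,d_i\mid i=0,\ldots,n-1\}$ and edge set $E(T_n'')=\{a_ia_{i+1},\,b_ib_{i+1},\,d_id_{i+1},\,a_ib_i,\,b_ic_i,\,c_id_i,\,b_{i+1}c_i,\,a_{i+1}b_i\mid i=0,\ldots,n-1\}$, with vertex indices taken modulo $n$. *)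

theory Defs
  imports Complex_Main "Graph_Theory.Pair_Digraph"
begin

text \<open>
  A finite undirected simple graph is a \<open>pair_graph\<close>: a symmetric loop-free set of ordered
  pairs over a finite vertex set, so each edge \<open>uv\<close> is represented by both \<open>(u, v)\<close> and \<open>(v, u)\<close>.
\<close>

definition open_nbhd :: "'a pair_pre_digraph \<Rightarrow> 'a \<Rightarrow> 'a set" where
  "open_nbhd G v = {u \<in> pverts G. (v, u) \<in> parcs G}"

definition closed_nbhd :: "'a pair_pre_digraph \<Rightarrow> 'a \<Rightarrow> 'a set" where
  "closed_nbhd G v = insert v (open_nbhd G v)"

text \<open>Values of \<open>f\<close> outside the vertex set are unconstrained and irrelevant.\<close>

definition srd_function :: "'a pair_pre_digraph \<Rightarrow> ('a \<Rightarrow> int) \<Rightarrow> bool" where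
  "srd_function G f \<longleftrightarrow>
     (\<forall>v \<in> pverts G. f v \<in> {-1, 1, 2}) \<and>
     (\<forall>v \<in> pverts G. (\<Sum>u \<in> closed_nbhd G v. f u) \<ge> 1) \<and>
     (\<forall>v \<in> pverts G. f v = -1 \<longrightarrow> (\<exists>u \<in> open_nbhd G v. f u = 2))"

definition srd_weight :: "'a pair_pre_digraph \<Rightarrow> ('a \<Rightarrow> int) \<Rightarrow> int" where
  "srd_weight G f = (\<Sum>v \<in> pverts G. f v)"

definition srd_number :: "'a pair_pre_digraph \<Rightarrow> int" where
  "srd_number G = Min {srd_weight G f | f. srd_function G f}"

text \<open>The minimum above is over a finite nonempty set, hence attained.\<close>

lemma finite_srd_weights:
  assumes "finite (pverts G)"
  shows "finite {srd_weight G f | f. srd_function G f}"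
proof (rule finite_subset)
  show "{srd_weight G f | f. srd_function G f}
          \<subseteq> {- int (card (pverts G)) .. 2 * int (card (pverts G))}"
  proof (clarsimp)
    fix f assume "srd_function G f"
    then have f: "-1 \<le> f v \<and> f v \<le> 2" if "v \<in> pverts G" for v
      using that unfolding srd_function_def by force
    have "(\<Sum>v \<in> pverts G. -1) \<le> srd_weight G f"
      unfolding srd_weight_def by (rule sum_mono) (use f in auto)
    moreover have "srd_weight G f \<le> (\<Sum>v \<in> pverts G. 2)"
      unfolding srd_weight_def by (rule sum_mono) (use f in auto)
    ultimately show "- int (card (pverts G)) \<le> srd_weight G f \<and>
        srd_weight G f \<le> 2 * int (card (pverts G))"
      by simp
  qed
qed simp

lemma srd_function_const_1:
  assumes "finite (pverts G)"
  shows "srd_function G (\<lambda>_. 1)"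
proof -
  have "finite (closed_nbhd G v)" for v
    using assms by (simp add: closed_nbhd_def open_nbhd_def)
  then have "card (closed_nbhd G v) > 0" for v
    unfolding card_gt_0_iff by (auto simp: closed_nbhd_def)
  then have "1 \<le> int (card (closed_nbhd G v))" for v
    by (metis int_one_le_iff_zero_less of_nat_0_less_iff)
  then show ?thesis
    by (simp add: srd_function_def)
qed

lemma srd_number_attained:
  assumes "finite (pverts G)"
  obtains f where "srd_function G f" "srd_weight G f = srd_number G"
proof -
  have "srd_number G \<in> {srd_weight G f | f. srd_function G f}"
    unfolding srd_number_def
    using finite_srd_weights[OF assms] srd_function_const_1[OF assms] by (intro Min_in) blast+
  then show thesis using that by auto
qed

lemma srd_number_le:
  assumes "finite (pverts G)" "srd_function G f"
  shows "srd_number G \<le> srd_weight G f"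
  unfolding srd_number_def using finite_srd_weights[OF assms(1)] assms(2) by (intro Min_le) blast+

datatype T_vertex = va nat | vb nat | vc nat | vd nat

definition T_edges :: "nat \<Rightarrow> (T_vertex \<times> T_vertex) set" where
  "T_edges n = (\<Union>i \<in> {..<n}.
     {(va i, va ((i + 1) mod n)), (vb i, vb ((i + 1) mod n)), (vd i, vd ((i + 1) mod n)),
      (va i, vb i), (vb i, vc i), (vc i, vd i),
      (vb ((i + 1) mod n), vc i), (va ((i + 1) mod n), vb i)})"

definition T_graph :: "nat \<Rightarrow> T_vertex pair_pre_digraph" where
  "T_graph n = \<lparr> pverts = (\<Union>i \<in> {..<n}. {va i, vb i, vc i, vd i}),
                 parcs = T_edges n \<union> (T_edges n)\<inverse> \<rparr>"

lemma pair_graph_T_graph: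
  assumes "n \<ge> 2"
  shows "pair_graph (T_graph n)"
proof -
  have loop: "(i + 1) mod n \<noteq> i" if "i < n" for i
    using assms that by (cases "i + 1 = n") auto
  have E: "(u, v) \<in> T_edges n \<Longrightarrow>
      u \<in> pverts (T_graph n) \<and> v \<in> pverts (T_graph n) \<and> u \<noteq> v" for u v
    using loop by (fastforce simp: T_edges_def T_graph_def)
  have fin: "finite (T_edges n)"
    by (simp add: T_edges_def)
  have "sym (parcs (T_graph n))"
    by (auto simp: T_graph_def sym_def)
  moreover have "finite (pverts (T_graph n))" "finite (parcs (T_graph n))"
    using fin by (auto simp: T_graph_def)
  moreover have "fst e \<in> pverts (T_graph n) \<and> snd e \<in> pverts (T_graph n) \<and> fst e \<noteq> snd e"
    if "e \<in> parcs (T_graph n)" for e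
  proof -
    obtain u v where [simp]: "e = (u, v)" by (cases e)
    have "(u, v) \<in> T_edges n \<or> (v, u) \<in> T_edges n"
      using that by (auto simp: T_graph_def)
    then show ?thesis using E by auto
  qed
  ultimately show ?thesis
    by unfold_locales (auto simp: symmetric_def arcs_ends_conv with_proj_def)
qed

lemma card_pverts_T_graph: "card (pverts (T_graph n)) = 4 * n"
proof -
  have "card (\<Union>i \<in> {..<n}. {va i, vb i, vc i, vd i}) = (\<Sum>i<n. card {va i, vb i, vc i, vd i})"
    by (rule card_UN_disjoint) auto
  then show ?thesis by (simp add: T_graph_def)
qed

end

theory Submission
  imports Defs
begin

text \<open>
  Lower bound: let \<open>A, B, C, D\<close> be the weights of the four rows. Summing condition (i) along the
  rows \<open>a, b, d\<close> gives \<open>3A + 2B \<ge> n\<close>, \<open>2A + 3B + 2C \<ge> n\<close> and \<open>C + 3D \<ge> n\<close>. Add these with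
  weights \<open>3, 3, 5\<close> to 4 times \<open>C \<ge> -n\<close>.

  Upper bound: put \<open>-1, 2, -1\<close> on the rows \<open>a, b, c\<close>, whose total weight is 0, and let the
  row \<open>d\<close> read \<open>2, 1, -1, 2, 1, -1, \<dots>\<close>. Cutting this pattern off at any length \<open>n \<ge> 3\<close> still
  leaves a cyclic word in which three consecutive entries sum to at least 2 and every \<open>-1\<close> is
  followed by a 2.
\<close>

text \<open>Addition modulo \<open>n\<close> on indices below \<open>n\<close>, written as a case
  split so that index equations reduce to linear arithmetic.\<close>

definition cyc_succ :: "nat \<Rightarrow> nat \<Rightarrow> nat" where
  "cyc_succ n i = (if Suc i = n then 0 else Suc i)"

definition cyc_pred :: "nat \<Rightarrow> nat \<Rightarrow> nat" where
  "cyc_pred n i = (if i = 0 then n - 1 else i - 1)"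

lemma mod_eq_cyc_succ: "i < n \<Longrightarrow> Suc i mod n = cyc_succ n i"
  by (auto simp: cyc_succ_def)

lemma cyc_succ_less: "i < n \<Longrightarrow> cyc_succ n i < n"
  by (auto simp: cyc_succ_def)

lemma cyc_pred_less: "i < n \<Longrightarrow> cyc_pred n i < n"
  by (auto simp: cyc_pred_def)

text \<open>Solves for the index \<open>j\<close> of an edge that arrives at column \<open>i\<close>
  from the column before. The next lemma covers the other orientation of the equation for the
  simplifier.\<close>

lemma cyc_succ_eq_iff: "i < n \<Longrightarrow> j < n \<Longrightarrow> cyc_succ n j = i \<longleftrightarrow> j = cyc_pred n i"
  by (auto simp: cyc_succ_def cyc_pred_def)

lemma eq_cyc_succ_iff: "i < n \<Longrightarrow> j < n \<Longrightarrow> i = cyc_succ n j \<longleftrightarrow> j = cyc_pred n i"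
  by (auto simp: cyc_succ_def cyc_pred_def)

lemma cyc_distinct:
  assumes "n \<ge> 3" "i < n"
  shows "cyc_succ n i \<noteq> i" "cyc_pred n i \<noteq> i" "cyc_succ n i \<noteq> cyc_pred n i"
  using assms by (auto simp: cyc_succ_def cyc_pred_def)

lemma sum_cyc_succ: "(\<Sum>i<n. g (cyc_succ n i)) = (\<Sum>i<n. g i)"
  by (rule sum.reindex_bij_witness[of _ "cyc_pred n" "cyc_succ n"])
    (auto simp: cyc_succ_def cyc_pred_def)

lemma sum_cyc_pred: "(\<Sum>i<n. g (cyc_pred n i)) = (\<Sum>i<n. g i)"
  by (rule sum.reindex_bij_witness[of _ "cyc_succ n" "cyc_pred n"])
    (auto simp: cyc_succ_def cyc_pred_def)

lemma T_edges_cyc: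
  "T_edges n = (\<Union>i \<in> {..<n}.
     {(va i, va (cyc_succ n i)), (vb i, vb (cyc_succ n i)), (vd i, vd (cyc_succ n i)),
      (va i, vb i), (vb i, vc i), (vc i, vd i),
      (vb (cyc_succ n i), vc i), (va (cyc_succ n i), vb i)})"
  unfolding T_edges_def by (rule SUP_cong) (simp_all add: mod_eq_cyc_succ)

lemma finite_pverts_T_graph: "finite (pverts (T_graph n))"
  by (simp add: T_graph_def)

lemma ball_pverts_T_graph:
  "(\<forall>v \<in> pverts (T_graph n). P v) \<longleftrightarrow> (\<forall>i<n. P (va i) \<and> P (vb i) \<and> P (vc i) \<and> P (vd i))"
  by (auto simp: T_graph_def)

lemma open_nbhd_T_graph:
  assumes "i < n"
  shows "open_nbhd (T_graph n) (va i) =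
      {va (cyc_succ n i), va (cyc_pred n i), vb i, vb (cyc_pred n i)}"
    and "open_nbhd (T_graph n) (vb i) =
      {vb (cyc_succ n i), vb (cyc_pred n i), va i, va (cyc_succ n i), vc i, vc (cyc_pred n i)}"
    and "open_nbhd (T_graph n) (vc i) = {vb i, vb (cyc_succ n i), vd i}"
    and "open_nbhd (T_graph n) (vd i) = {vd (cyc_succ n i), vd (cyc_pred n i), vc i}"
  using assms
  by (auto simp: open_nbhd_def T_graph_def T_edges_cyc cyc_succ_less cyc_pred_less
      cyc_succ_eq_iff eq_cyc_succ_iff)

text \<open>For \<open>n \<ge> 3\<close> the columns before, at and after \<open>i\<close> are
  distinct, so the vertices listed in each neighbourhood do not coincide and each contributes its
  own summand.\<close>

lemma sum_closed_nbhd_T_graph: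
  assumes "n \<ge> 3" "i < n"
  shows "(\<Sum>u \<in> closed_nbhd (T_graph n) (va i). f u) =
      f (va i) + f (va (cyc_succ n i)) + f (va (cyc_pred n i)) + f (vb i) + f (vb (cyc_pred n i))"
    and "(\<Sum>u \<in> closed_nbhd (T_graph n) (vb i). f u) =
      f (vb i) + f (vb (cyc_succ n i)) + f (vb (cyc_pred n i)) + f (va i) + f (va (cyc_succ n i))
        + f (vc i) + f (vc (cyc_pred n i))"
    and "(\<Sum>u \<in> closed_nbhd (T_graph n) (vc i). f u) =
      f (vc i) + f (vb i) + f (vb (cyc_succ n i)) + f (vd i)"
    and "(\<Sum>u \<in> closed_nbhd (T_graph n) (vd i). f u) =
      f (vd i) + f (vd (cyc_succ n i)) + f (vd (cyc_pred n i)) + f (vc i)"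
  using cyc_distinct[OF assms] cyc_distinct[OF assms, symmetric]
  by (simp_all add: closed_nbhd_def open_nbhd_T_graph assms add.assoc)

lemma srd_weight_T_graph:
  "srd_weight (T_graph n) f =
     (\<Sum>i<n. f (va i)) + (\<Sum>i<n. f (vb i)) + (\<Sum>i<n. f (vc i)) + (\<Sum>i<n. f (vd i))"
proof -
  have "(\<Sum>v \<in> (\<Union>i \<in> {..<n}. {va i, vb i, vc i, vd i}). f v) =
      (\<Sum>i<n. \<Sum>v \<in> {va i, vb i, vc i, vd i}. f v)"
    by (rule sum.UNION_disjoint) auto
  then show ?thesis
    by (simp add: srd_weight_def T_graph_def sum.distrib)
qed

lemma srd_weight_T_graph_ge:
  assumes "n \<ge> 3" "srd_function (T_graph n) f"
  shows "7 * int n \<le> 15 * srd_weight (T_graph n) f"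
proof -
  define A B C D where "A = (\<Sum>i<n. f (va i))" and "B = (\<Sum>i<n. f (vb i))"
    and "C = (\<Sum>i<n. f (vc i))" and "D = (\<Sum>i<n. f (vd i))"
  have nbhd: "\<forall>i<n. 1 \<le> (\<Sum>u \<in> closed_nbhd (T_graph n) (va i). f u)"
    "\<forall>i<n. 1 \<le> (\<Sum>u \<in> closed_nbhd (T_graph n) (vb i). f u)"
    "\<forall>i<n. 1 \<le> (\<Sum>u \<in> closed_nbhd (T_graph n) (vd i). f u)"
    and "\<forall>i<n. f (vc i) \<in> {-1, 1, 2}"
    using assms(2) unfolding srd_function_def ball_pverts_T_graph by blast+
  then have c_ge: "\<forall>i<n. -1 \<le> f (vc i)"
    by auto
  have sum_ge: "int n * m \<le> (\<Sum>i<n. g i)" if "\<forall>i<n. m \<le> g i" for m and g :: "nat \<Rightarrow> int"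
    using sum_mono[of "{..<n}" "\<lambda>_. m" g] that by simp
  \<comment> \<open>Shifting a row cyclically preserves its sum, so each shifted copy again
    contributes \<open>A\<close>, \<open>B\<close>, \<open>C\<close> or \<open>D\<close>.\<close>
  note eqs = sum_closed_nbhd_T_graph[OF assms(1)] sum.distrib
    sum_cyc_succ[of "\<lambda>i. f (va i)"] sum_cyc_pred[of "\<lambda>i. f (va i)"]
    sum_cyc_succ[of "\<lambda>i. f (vb i)"] sum_cyc_pred[of "\<lambda>i. f (vb i)"]
    sum_cyc_pred[of "\<lambda>i. f (vc i)"]
    sum_cyc_succ[of "\<lambda>i. f (vd i)"] sum_cyc_pred[of "\<lambda>i. f (vd i)"]
  have "int n \<le> 3 * A + 2 * B"
    using sum_ge[OF nbhd(1)] by (simp add: eqs A_def B_def)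
  moreover have "int n \<le> 2 * A + 3 * B + 2 * C"
    using sum_ge[OF nbhd(2)] by (simp add: eqs A_def B_def C_def)
  moreover have "int n \<le> C + 3 * D"
    using sum_ge[OF nbhd(3)] by (simp add: eqs C_def D_def)
  moreover have "- int n \<le> C"
    using sum_ge[OF c_ge] by (simp add: C_def)
  \<comment> \<open>With multipliers 3, 3, 5, 4 every row sum gets coefficient 15, and the constants
    give 3n + 3n + 5n - 4n = 7n.\<close>
  ultimately have "7 * int n \<le> 15 * (A + B + C + D)"
    by (simp add: distrib_left)
  then show ?thesis
    by (simp add: srd_weight_T_graph A_def B_def C_def D_def)
qed

definition d_row :: "nat \<Rightarrow> int" where
  "d_row i = (if i mod 3 = 0 then 2 else if i mod 3 = 1 then 1 else -1)"

fun T_labelling :: "T_vertex \<Rightarrow> int" where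
  "T_labelling (va i) = -1"
| "T_labelling (vb i) = 2"
| "T_labelling (vc i) = -1"
| "T_labelling (vd i) = d_row i"

lemma d_row_0: "d_row 0 = 2"
  by (simp add: d_row_def)

lemma d_row_Suc_eq_2: "d_row i = -1 \<Longrightarrow> d_row (Suc i) = 2"
  by (simp add: d_row_def mod_Suc split: if_splits)

text \<open>A window inside the word is a full period, of sum 2 + 1 - 1. At \<open>i = 0\<close> it
  contains 2 + 1 and an entry at least -1; at \<open>i = n - 1\<close> it contains the initial 2 and
  two consecutive entries, whose sum is at least 0.\<close>

lemma d_row_window:
  assumes "n \<ge> 3" "i < n"
  shows "d_row i + d_row (cyc_succ n i) + d_row (cyc_pred n i) \<ge> 2"
proof (cases i)
  case 0
  then show ?thesis
    using assms by (simp add: cyc_succ_def cyc_pred_def d_row_def)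
next
  case (Suc j)
  have "j mod 3 = 0 \<or> j mod 3 = 1 \<or> j mod 3 = 2"
    by presburger
  then show ?thesis
    using Suc by (auto simp: cyc_succ_def cyc_pred_def d_row_def mod_Suc)
qed

text \<open>The sums for n = 3k, 3k + 1, 3k + 2 are 2k, 2k + 2, 2k + 3. The quotient is the ceiling
  of 2n/3 in integer form.\<close>

lemma sum_d_row: "(\<Sum>i<n. d_row i) = (2 * int n + 2) div 3 + (if 3 dvd n then 0 else 1)"
proof (induction n)
  case (Suc n)
  have "n mod 3 = 0 \<or> n mod 3 = 1 \<or> n mod 3 = 2"
    by presburger
  then obtain k where "n = 3 * k \<or> n = 3 * k + 1 \<or> n = 3 * k + 2"
    by (metis mult_div_mod_eq add_0_right)
  \<comment> \<open>The new entry is exactly the increment of the closed form.\<close>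
  then have "d_row n + ((2 * int n + 2) div 3 + (if 3 dvd n then 0 else 1)) =
      (2 * int (Suc n) + 2) div 3 + (if 3 dvd Suc n then 0 else 1)"
    by (elim disjE; simp add: d_row_def dvd_eq_mod_eq_0 mod_Suc; presburger)
  with Suc show ?case
    by simp
qed simp

lemma srd_function_T_labelling:
  assumes "n \<ge> 3"
  shows "srd_function (T_graph n) T_labelling"
proof -
  \<comment> \<open>The neighbourhood sums are 1 on row a, 2 on row b and 3 + \<open>d_row i\<close>
    on row c; only row d needs the window bound. In rows a and c, b_i supplies the neighbour of
    value 2.\<close>
  have "d_row i = -1 \<or> d_row i = 1 \<or> d_row i = 2" "0 \<le> 2 + d_row i" for i
    by (simp_all add: d_row_def)
  moreover have "d_row (cyc_succ n i) = 2" if "d_row i = -1" for i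
    \<comment> \<open>If the word is cut right after any entry, the cyclic successor is position 0,
      whose value is 2.\<close>
    using d_row_Suc_eq_2[OF that] by (simp add: cyc_succ_def d_row_0)
  moreover have "1 \<le> d_row i + d_row (cyc_succ n i) + d_row (cyc_pred n i) - 1" if "i < n" for i
    using d_row_window[OF assms that] by simp
  ultimately show ?thesis
    unfolding srd_function_def ball_pverts_T_graph
    by (simp add: sum_closed_nbhd_T_graph[OF assms] open_nbhd_T_graph)
qed

lemma srd_weight_T_labelling:
  "srd_weight (T_graph n) T_labelling = (2 * int n + 2) div 3 + (if 3 dvd n then 0 else 1)"
  by (simp add: srd_weight_T_graph sum_d_row)

lemma ceiling_two_thirds: "\<lceil>2 * real n / 3\<rceil> = (2 * int n + 2) div 3"
proof (rule ceiling_unique)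
  \<comment> \<open>The two bounds that characterise the ceiling, cleared of denominators so that
    they can be proved over the integers.\<close>
  have "2 * int n \<le> 3 * ((2 * int n + 2) div 3)" "3 * ((2 * int n + 2) div 3) < 2 * int n + 3"
    by presburger+
  then have "real_of_int (2 * int n) \<le> real_of_int (3 * ((2 * int n + 2) div 3))"
    "real_of_int (3 * ((2 * int n + 2) div 3)) < real_of_int (2 * int n + 3)"
    by (simp_all only: of_int_le_iff of_int_less_iff)
  then show "real_of_int ((2 * int n + 2) div 3) - 1 < 2 * real n / 3"
    "2 * real n / 3 \<le> real_of_int ((2 * int n + 2) div 3)"
    by simp_all
qed

theorem theorem7:
  fixes n :: nat
  assumes "n \<ge> 5"
  shows "7 * real n / 15 \<le> real_of_int (srd_number (T_graph n)) \<and>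
         srd_number (T_graph n) \<le>
           (if 3 dvd n then \<lceil>2 * real n / 3\<rceil> else \<lceil>2 * real n / 3\<rceil> + 1)"
proof
  have n: "n \<ge> 3"
    using assms by simp
  obtain f where "srd_function (T_graph n) f" "srd_weight (T_graph n) f = srd_number (T_graph n)"
    by (rule srd_number_attained[OF finite_pverts_T_graph])
  with srd_weight_T_graph_ge[OF n] have "7 * int n \<le> 15 * srd_number (T_graph n)"
    by metis
  then have "real_of_int (7 * int n) \<le> real_of_int (15 * srd_number (T_graph n))"
    by (simp only: of_int_le_iff)
  then show "7 * real n / 15 \<le> real_of_int (srd_number (T_graph n))"
    by simp
  have "srd_number (T_graph n) \<le> srd_weight (T_graph n) T_labelling"
    by (rule srd_number_le[OF finite_pverts_T_graph srd_function_T_labelling[OF n]])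
  then show "srd_number (T_graph n) \<le>
      (if 3 dvd n then \<lceil>2 * real n / 3\<rceil> else \<lceil>2 * real n / 3\<rceil> + 1)"
    by (cases "3 dvd n") (simp_all add: srd_weight_T_labelling ceiling_two_thirds)
qed

end
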